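(* Let $(M,g,q)$ be a $3$-dimensional Riemannian manifold with circulant structure $q$ as in the context, let $f$ be the associated metric, and let $p\in M$. Let $u\in T_pM$ with $g(u,u)=1$ and $qu\neq u$, suppose that $u$ and $qu$ span a $2$-plane $\alpha$ in $T_pM$, and let $\varphi=\angle(u,qu)\in(0,\frac{2\pi}{3}]$ be the $g$-angle between $u$ and $qu$. Put $$w=\frac{1}{\sin\varphi}\left(-\cos\varphi\, u+qu\right),$$ and let $p_{xy}$ be the coordinate system on $\alpha$ with origin $p$ (the zero vector) and axes directed along $u$ and $w$, so that the point $(x,y)$ has radius vector $v=xu+yw$. Let $r^2$ denote a real constant (possibly zero or negative) and let $k$ be the set of points of $\alpha$ whose radius vector $v$ satisfies $f(v,v)=r^2$. Then the equation of $k$ in the coordinates $(x,y)$ is $$(\cos\varphi)\,x^{2}+\frac{(1-\cos\varphi)(1+2\cos\varphi)}{\sin\varphi}\,xy-\frac{\cos^{2}\varphi}{1+\cos\varphi}\,y^{2}=\frac{r^{2}}{2}.$$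
   Context: $(M,g,q)$ denotes a $3$-dimensional differentiable manifold $M$ with a $(1,1)$-tensor field $q$ whose components in a local coordinate system form the circulant matrix $\begin{pmatrix}0&1&0\\0&0&1\\1&0&0\end{pmatrix}$ (so $q^3=\mathrm{id}$), and a positive definite metric $g$ with $g(qu,qv)=g(u,v)$ for all $u,v$. The associated metric is $f(u,v)=g(u,qv)+g(qu,v)$; it is indefinite. The angle $\varphi=\angle(u,qu)$ is determined by $\cos\varphi=g(u,qu)/g(u,u)$; it is known that it always lies in $[0,\frac{2\pi}{3}]$. The set $k$ is called the circle in $\alpha$ of radius $r$ centered at $p$ with respect to $f$. *)

theory Defs
  imports "HOL-Analysis.Analysis" "HOL-Library.Function_Algebras"
begin

section \<open>Smooth maps between Euclidean spaces\<close>

text \<open>\<open>C_on n S f\<close> is meant for open \<open>S\<close>: \<open>f\<close> has continuous iterated directional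
  derivatives up to order \<open>n\<close> on \<open>S\<close>.\<close>

primrec C_on :: "nat \<Rightarrow> 'a::euclidean_space set \<Rightarrow> ('a \<Rightarrow> 'b::real_normed_vector) \<Rightarrow> bool" where
  "C_on 0 S f \<longleftrightarrow> continuous_on S f"
| "C_on (Suc n) S f \<longleftrightarrow> (\<forall>x\<in>S. f differentiable (at x)) \<and>
     (\<forall>v. C_on n S (\<lambda>x. frechet_derivative f (at x) v))"

definition smooth_on :: "'a::euclidean_space set \<Rightarrow> ('a \<Rightarrow> 'b::real_normed_vector) \<Rightarrow> bool" where
  "smooth_on S f \<longleftrightarrow> (\<forall>n. C_on n S f)"


section \<open>Three-dimensional differentiable manifolds\<close>

text \<open>A chart is a domain together with a coordinate map; the values of the map
  outside the domain are irrelevant.\<close>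

type_synonym 'a chart = "'a set \<times> ('a \<Rightarrow> real^3)"

definition is_chart :: "'a topology \<Rightarrow> 'a chart \<Rightarrow> bool" where
  "is_chart X c \<longleftrightarrow> openin X (fst c) \<and> open (snd c ` fst c) \<and>
     homeomorphic_map (subtopology X (fst c)) (top_of_set (snd c ` fst c)) (snd c)"

definition transition :: "'a chart \<Rightarrow> 'a chart \<Rightarrow> real^3 \<Rightarrow> real^3" where
  "transition c d = snd d \<circ> inv_into (fst c) (snd c)"

definition compatible :: "'a chart \<Rightarrow> 'a chart \<Rightarrow> bool" where
  "compatible c d \<longleftrightarrow>
     smooth_on (snd c ` (fst c \<inter> fst d)) (transition c d) \<and>
     smooth_on (snd d ` (fst c \<inter> fst d)) (transition d c)"

locale manifold3 =
  fixes X :: "'a topology" and A :: "'a chart set"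
  assumes Hausdorff: "Hausdorff_space X"
    and second_countable: "second_countable X"
    and charts: "\<And>c. c \<in> A \<Longrightarrow> is_chart X c"
    and cover: "(\<Union>c\<in>A. fst c) = topspace X"
    and compat: "\<And>c d. c \<in> A \<Longrightarrow> d \<in> A \<Longrightarrow> compatible c d"
    and maximal: "\<And>c. is_chart X c \<Longrightarrow> (\<And>d. d \<in> A \<Longrightarrow> compatible c d) \<Longrightarrow> c \<in> A"


section \<open>Tangent vectors\<close>

text \<open>A tangent vector at \<open>p\<close> is the family of its component vectors with respect to the
  charts around \<open>p\<close>, related by the Jacobians of the coordinate changes (and zero
  on all other charts). The linear structure is the pointwise one, which the following
  instance makes available as a real vector space.\<close>

instantiation "fun" :: (type, real_vector) real_vector
begin

definition scaleR_fun :: "real \<Rightarrow> ('a \<Rightarrow> 'b) \<Rightarrow> 'a \<Rightarrow> 'b" where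
  "scaleR_fun a f = (\<lambda>x. a *\<^sub>R f x)"

instance
  by standard (simp_all add: scaleR_fun_def fun_eq_iff scaleR_add_right scaleR_add_left)

end

type_synonym 'a tvec = "'a chart \<Rightarrow> real^3"

definition charts_at :: "'a chart set \<Rightarrow> 'a \<Rightarrow> 'a chart set" where
  "charts_at A p = {c \<in> A. p \<in> fst c}"

definition tangent_space :: "'a chart set \<Rightarrow> 'a \<Rightarrow> 'a tvec set" where
  "tangent_space A p = {v.
     (\<forall>c. c \<notin> charts_at A p \<longrightarrow> v c = 0) \<and>
     (\<forall>c\<in>charts_at A p. \<forall>d\<in>charts_at A p.
        v d = frechet_derivative (transition c d) (at (snd c p)) (v c))}"

text \<open>The coordinate vector \<open>\<partial>/\<partial>x\<^sup>i\<close> of the chart \<open>c\<close> at \<open>p\<close>.\<close>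

definition coord_vec :: "'a chart set \<Rightarrow> 'a chart \<Rightarrow> 'a \<Rightarrow> 3 \<Rightarrow> 'a tvec" where
  "coord_vec A c p i = (\<lambda>d. if d \<in> charts_at A p
     then frechet_derivative (transition c d) (at (snd c p)) (axis i 1) else 0)"


section \<open>Tensor fields\<close>

text \<open>Upper index \<open>i\<close> is the row and lower index \<open>j\<close> the column of the component matrix
  of a (1,1)-tensor, so that it acts on columns of vector components. The opposite convention
  would transpose the circulant matrix below; renumbering the coordinates
  undoes this, and the maximal atlas contains the renumbered charts.\<close>

definition endo_components ::
    "'a chart set \<Rightarrow> ('a \<Rightarrow> 'a tvec \<Rightarrow> 'a tvec) \<Rightarrow> 'a chart \<Rightarrow> 'a \<Rightarrow> real^3^3" where
  "endo_components A q c p = (\<chi> i j. q p (coord_vec A c p j) c $ i)"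

definition form_components ::
    "'a chart set \<Rightarrow> ('a \<Rightarrow> 'a tvec \<Rightarrow> 'a tvec \<Rightarrow> real) \<Rightarrow> 'a chart \<Rightarrow> 'a \<Rightarrow> real^3^3" where
  "form_components A g c p = (\<chi> i j. g p (coord_vec A c p i) (coord_vec A c p j))"

definition linear_field_on :: "'a tvec set \<Rightarrow> ('a tvec \<Rightarrow> 'b::real_vector) \<Rightarrow> bool" where
  "linear_field_on T h \<longleftrightarrow> (\<forall>u\<in>T. \<forall>v\<in>T. h (u + v) = h u + h v) \<and>
     (\<forall>a. \<forall>u\<in>T. h (a *\<^sub>R u) = a *\<^sub>R h u)"

locale riemannian_manifold3 = manifold3 +
  fixes g :: "'a \<Rightarrow> 'a tvec \<Rightarrow> 'a tvec \<Rightarrow> real"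
  assumes g_linear: "\<And>p u. p \<in> topspace X \<Longrightarrow> u \<in> tangent_space A p \<Longrightarrow>
      linear_field_on (tangent_space A p) (g p u)"
    and g_sym: "\<And>p u v. p \<in> topspace X \<Longrightarrow> u \<in> tangent_space A p \<Longrightarrow>
      v \<in> tangent_space A p \<Longrightarrow> g p u v = g p v u"
    and g_pos: "\<And>p u. p \<in> topspace X \<Longrightarrow> u \<in> tangent_space A p \<Longrightarrow> u \<noteq> 0 \<Longrightarrow> g p u u > 0"
    and g_smooth: "\<And>c. c \<in> A \<Longrightarrow>
      smooth_on (snd c ` fst c) (\<lambda>x. form_components A g c (inv_into (fst c) (snd c) x))"

definition circulant :: "real^3^3" where
  "circulant = vector [vector [0, 1, 0], vector [0, 0, 1], vector [1, 0, 0]]"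

locale circulant_manifold3 = riemannian_manifold3 +
  fixes q :: "'a \<Rightarrow> 'a tvec \<Rightarrow> 'a tvec"
  assumes q_tangent: "\<And>p u. p \<in> topspace X \<Longrightarrow> u \<in> tangent_space A p \<Longrightarrow>
      q p u \<in> tangent_space A p"
    and q_linear: "\<And>p. p \<in> topspace X \<Longrightarrow> linear_field_on (tangent_space A p) (q p)"
    and q_smooth: "\<And>c. c \<in> A \<Longrightarrow>
      smooth_on (snd c ` fst c) (\<lambda>x. endo_components A q c (inv_into (fst c) (snd c) x))"
    and q_circulant: "\<And>p. p \<in> topspace X \<Longrightarrow>
      \<exists>c\<in>charts_at A p. \<forall>p'\<in>fst c. endo_components A q c p' = circulant"
    and q_isometry: "\<And>p u v. p \<in> topspace X \<Longrightarrow> u \<in> tangent_space A p \<Longrightarrow>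
      v \<in> tangent_space A p \<Longrightarrow> g p (q p u) (q p v) = g p u v"

definition associated_metric ::
    "('a \<Rightarrow> 'a tvec \<Rightarrow> 'a tvec \<Rightarrow> real) \<Rightarrow> ('a \<Rightarrow> 'a tvec \<Rightarrow> 'a tvec) \<Rightarrow>
     'a \<Rightarrow> 'a tvec \<Rightarrow> 'a tvec \<Rightarrow> real" where
  "associated_metric g q p u v = g p u (q p v) + g p (q p u) v"

definition angle :: "('v \<Rightarrow> 'v \<Rightarrow> real) \<Rightarrow> 'v \<Rightarrow> 'v \<Rightarrow> real" where
  "angle h u v = arccos (h u v / (sqrt (h u u) * sqrt (h v v)))"

text \<open>Points of a plane \<open>\<alpha>\<close> in the tangent space at \<open>p\<close> are identified with their radius
  vectors from \<open>p\<close>. The second argument stands for the squared radius, which may be any real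
  number since \<open>f\<close> is indefinite.\<close>

definition circle_in :: "'v set \<Rightarrow> real \<Rightarrow> ('v \<Rightarrow> 'v \<Rightarrow> real) \<Rightarrow> 'v set" where
  "circle_in \<alpha> r2 f = {v \<in> \<alpha>. f v v = r2}"

text \<open>The point with coordinates \<open>(x, y)\<close> with respect to axes along \<open>u\<close> and \<open>w\<close>.\<close>

definition plane_coords :: "'v::real_vector \<Rightarrow> 'v \<Rightarrow> real \<times> real \<Rightarrow> 'v" where
  "plane_coords u w = (\<lambda>(x, y). x *\<^sub>R u + y *\<^sub>R w)"

end

theory Submission
  imports Defs
begin

text \<open>
  Everything happens in the single tangent space at \<open>p\<close>. The manifold enters only through
  the identity \<open>q\<^sup>3 = id\<close> there: in a chart where \<open>q\<close> is circulant, the Jacobians of the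
  coordinate changes satisfy the chain rule, so that the coordinate vectors are tangent vectors,
  every tangent vector is their combination with its own components as coefficients, and \<open>q\<close>
  acts on components by cyclic permutation (lemmas \<open>tangent_vector_expansion\<close>,
  \<open>endo_apply_components\<close>, \<open>q_cubed\<close>).

  The rest is linear algebra. Since \<open>q\<close> is an isometry of order three, the vectors \<open>u\<close>, \<open>q u\<close>,
  \<open>q\<^sup>2 u\<close> are unit vectors and any two of them have the same inner product \<open>cos \<phi>\<close>.
  Hence on \<open>v = a u + b (q u)\<close> the quadratic form of \<open>f\<close> is
  \<open>f(v, v) = 2 g(v, q v) = 2 (cos \<phi> (a\<^sup>2 + b\<^sup>2) + (1 + cos \<phi>) a b)\<close>.
  The vector \<open>w\<close> is the Gram--Schmidt partner of \<open>u\<close> in the plane spanned by \<open>u\<close> and \<open>q u\<close>, so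
  \<open>(x, y)\<close> are orthonormal coordinates, and substituting
  \<open>a = x - y cos \<phi> / sin \<phi>\<close>, \<open>b = y / sin \<phi>\<close> gives the equation.
\<close>

section \<open>Tangent vectors and their components\<close>

lemma sum_fun_apply: "(\<Sum>i\<in>I. F i) x = (\<Sum>i\<in>I. F i x)"
  by (induction I rule: infinite_finite_induct) simp_all

lemma linear_field_on_add:
  "linear_field_on T h \<Longrightarrow> u \<in> T \<Longrightarrow> v \<in> T \<Longrightarrow> h (u + v) = h u + h v"
  unfolding linear_field_on_def by simp

lemma linear_field_on_scale:
  "linear_field_on T h \<Longrightarrow> u \<in> T \<Longrightarrow> h (a *\<^sub>R u) = a *\<^sub>R h u"
  unfolding linear_field_on_def by simp

lemma linear_field_on_zero:
  assumes "linear_field_on T h" "subspace T"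
  shows "h 0 = 0"
  using linear_field_on_scale[OF assms(1) subspace_0[OF assms(2)], of 0] by simp

lemma linear_field_on_sum:
  assumes h: "linear_field_on T h" and T: "subspace T" and F: "\<And>i. i \<in> I \<Longrightarrow> F i \<in> T"
  shows "h (\<Sum>i\<in>I. a i *\<^sub>R F i) = (\<Sum>i\<in>I. a i *\<^sub>R h (F i))"
  using F
proof (induction I rule: infinite_finite_induct)
  case (insert i I)
  have F_I: "F j \<in> T" if "j \<in> I" for j
    using insert.prems that by blast
  have F_i: "a i *\<^sub>R F i \<in> T" "F i \<in> T"
    using insert.prems[of i] by (simp_all add: subspace_scale[OF T])
  have sum_T: "(\<Sum>i\<in>I. a i *\<^sub>R F i) \<in> T"
    by (intro subspace_sum subspace_scale T F_I)
  show ?case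
    by (simp only: sum.insert[OF insert.hyps] linear_field_on_add[OF h F_i(1) sum_T]
        linear_field_on_scale[OF h F_i(2)] insert.IH[OF F_I])
qed (simp_all add: linear_field_on_zero[OF h T])

context manifold3
begin

lemma chart_inj_on:
  assumes "c \<in> A"
  shows "inj_on (snd c) (fst c)"
proof -
  have "fst c \<subseteq> topspace X"
    using cover assms by blast
  then show ?thesis
    using charts[OF assms] homeomorphic_imp_injective_map
    unfolding is_chart_def by (fastforce simp: inf_absorb2)
qed

lemma chart_image_open:
  assumes "c \<in> A" "openin X U" "U \<subseteq> fst c"
  shows "open (snd c ` U)"
proof -
  have "openin (subtopology X (fst c)) U"
    using assms(2,3) by (auto simp: openin_subtopology intro!: exI[of _ U])
  then have "openin (top_of_set (snd c ` fst c)) (snd c ` U)"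
    using charts[OF assms(1)] homeomorphic_imp_open_map
    unfolding is_chart_def open_map_def by blast
  then show ?thesis
    using charts[OF assms(1)] unfolding is_chart_def by (simp add: openin_open_eq)
qed

lemma chart_inv_into:
  assumes "c \<in> A" "p \<in> fst c"
  shows "inv_into (fst c) (snd c) (snd c p) = p"
  using chart_inj_on assms by simp

lemma transition_apply:
  assumes "c \<in> A" "p \<in> fst c"
  shows "transition c d (snd c p) = snd d p"
  using chart_inv_into assms by (simp add: transition_def)

lemma transition_has_derivative:
  assumes "c \<in> charts_at A p" "d \<in> charts_at A p"
  shows "(transition c d has_derivative frechet_derivative (transition c d) (at (snd c p)))
    (at (snd c p))"
proof -
  have "smooth_on (snd c ` (fst c \<inter> fst d)) (transition c d)"
    using compat assms unfolding compatible_def charts_at_def by blast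
  then have "C_on (Suc 0) (snd c ` (fst c \<inter> fst d)) (transition c d)"
    unfolding smooth_on_def by blast
  moreover have "snd c p \<in> snd c ` (fst c \<inter> fst d)"
    using assms by (auto simp: charts_at_def)
  ultimately show ?thesis
    unfolding C_on.simps frechet_derivative_works by blast
qed

lemma transition_derivative_linear:
  assumes "c \<in> charts_at A p" "d \<in> charts_at A p"
  shows "linear (frechet_derivative (transition c d) (at (snd c p)))"
  using transition_has_derivative[OF assms] by (rule has_derivative_linear)

text \<open>The cocycle condition: near \<open>p\<close>, passing from \<open>c\<close> to \<open>e\<close> through \<open>d\<close> is the direct change of
  coordinates, hence the chain rule.\<close>

lemma transition_derivative_chain:
  assumes c: "c \<in> charts_at A p" and d: "d \<in> charts_at A p" and e: "e \<in> charts_at A p"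
  shows "frechet_derivative (transition c e) (at (snd c p)) x =
    frechet_derivative (transition d e) (at (snd d p))
      (frechet_derivative (transition c d) (at (snd c p)) x)"
proof -
  let ?U = "fst c \<inter> fst d \<inter> fst e"
  let ?D = "frechet_derivative (transition d e) (at (snd d p)) \<circ>
      frechet_derivative (transition c d) (at (snd c p))"
  have A: "c \<in> A" "d \<in> A" "e \<in> A" and p: "p \<in> ?U"
    using assms by (auto simp: charts_at_def)
  have "openin X ?U"
    using charts A unfolding is_chart_def by blast
  then have "open (snd c ` ?U)"
    by (intro chart_image_open A) auto
  moreover have "snd c p \<in> snd c ` ?U"
    using p by blast
  moreover have "(transition d e \<circ> transition c d) y = transition c e y"
    if "y \<in> snd c ` ?U" for y
    using that A by (auto simp: transition_apply)
  moreover have "(transition d e \<circ> transition c d has_derivative ?D) (at (snd c p))"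
  proof (rule diff_chain_at)
    show "(transition d e has_derivative frechet_derivative (transition d e) (at (snd d p)))
        (at (transition c d (snd c p)))"
      using transition_has_derivative[OF d e] p A by (simp add: transition_apply)
  qed (rule transition_has_derivative[OF c d])
  ultimately have "(transition c e has_derivative ?D) (at (snd c p))"
    using has_derivative_transform_within_open
      [of "transition d e \<circ> transition c d" ?D "snd c p" UNIV "snd c ` ?U"] by simp
  from fun_cong[OF frechet_derivative_at[OF this], of x] show ?thesis
    by simp
qed

lemma transition_derivative_self:
  assumes "c \<in> charts_at A p"
  shows "frechet_derivative (transition c c) (at (snd c p)) x = x"
proof -
  have c: "c \<in> A" "p \<in> fst c"
    using assms by (auto simp: charts_at_def)
  have "open (snd c ` fst c)"
    using charts c unfolding is_chart_def by blast
  moreover have "y = transition c c y" if "y \<in> snd c ` fst c" for y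
    using that c by (auto simp: transition_apply)
  ultimately have "(transition c c has_derivative (\<lambda>x. x)) (at (snd c p))"
    using has_derivative_transform_within_open[OF has_derivative_ident] c by blast
  from fun_cong[OF frechet_derivative_at[OF this], of x] show ?thesis
    by simp
qed

lemma tangent_spaceI:
  assumes "\<And>c. c \<notin> charts_at A p \<Longrightarrow> v c = 0"
    and "\<And>c d. c \<in> charts_at A p \<Longrightarrow> d \<in> charts_at A p \<Longrightarrow>
      v d = frechet_derivative (transition c d) (at (snd c p)) (v c)"
  shows "v \<in> tangent_space A p"
  unfolding tangent_space_def using assms by blast

lemma tangent_vector_outside:
  assumes "v \<in> tangent_space A p" "d \<notin> charts_at A p"
  shows "v d = 0"
  using assms unfolding tangent_space_def by blast

lemma tangent_vector_transform:
  assumes "v \<in> tangent_space A p" "c \<in> charts_at A p" "d \<in> charts_at A p"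
  shows "v d = frechet_derivative (transition c d) (at (snd c p)) (v c)"
  using assms unfolding tangent_space_def by blast

lemma subspace_tangent_space: "subspace (tangent_space A p)"
proof (rule subspaceI)
  show "0 \<in> tangent_space A p"
    by (rule tangent_spaceI) (simp_all add: linear_0[OF transition_derivative_linear])
next
  fix u v assume uv: "u \<in> tangent_space A p" "v \<in> tangent_space A p"
  show "u + v \<in> tangent_space A p"
  proof (rule tangent_spaceI)
    show "(u + v) c = 0" if "c \<notin> charts_at A p" for c
      using uv that by (simp add: tangent_vector_outside)
    show "(u + v) d = frechet_derivative (transition c d) (at (snd c p)) ((u + v) c)"
      if "c \<in> charts_at A p" "d \<in> charts_at A p" for c d
      using uv[THEN tangent_vector_transform, OF that]
        linear_add[OF transition_derivative_linear[OF that]] by simp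
  qed
next
  fix a v assume v: "v \<in> tangent_space A p"
  show "a *\<^sub>R v \<in> tangent_space A p"
  proof (rule tangent_spaceI)
    show "(a *\<^sub>R v) c = 0" if "c \<notin> charts_at A p" for c
      using v that by (simp add: tangent_vector_outside scaleR_fun_def)
    show "(a *\<^sub>R v) d = frechet_derivative (transition c d) (at (snd c p)) ((a *\<^sub>R v) c)"
      if "c \<in> charts_at A p" "d \<in> charts_at A p" for c d
      using tangent_vector_transform[OF v that]
        linear_cmul[OF transition_derivative_linear[OF that]] by (simp add: scaleR_fun_def)
  qed
qed

text \<open>One chart around the point already carries the whole tangent vector.\<close>

lemma tangent_vector_eqI:
  assumes "u \<in> tangent_space A p" "v \<in> tangent_space A p" "c \<in> charts_at A p" "u c = v c"
  shows "u = v"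
proof
  fix d
  show "u d = v d"
  proof (cases "d \<in> charts_at A p")
    case True
    show ?thesis
      unfolding tangent_vector_transform[OF assms(1,3) True]
        tangent_vector_transform[OF assms(2,3) True] assms(4) ..
  next
    case False
    then show ?thesis
      using assms(1,2) by (simp add: tangent_vector_outside)
  qed
qed

lemma coord_vec_in_tangent_space:
  assumes "c \<in> charts_at A p"
  shows "coord_vec A c p i \<in> tangent_space A p"
proof (rule tangent_spaceI)
  show "coord_vec A c p i d = 0" if "d \<notin> charts_at A p" for d
    using that by (simp add: coord_vec_def)
  show "coord_vec A c p i e =
      frechet_derivative (transition d e) (at (snd d p)) (coord_vec A c p i d)"
    if "d \<in> charts_at A p" "e \<in> charts_at A p" for d e
    using that transition_derivative_chain[OF assms that] by (simp add: coord_vec_def)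
qed

lemma coord_vec_apply_self:
  assumes "c \<in> charts_at A p"
  shows "coord_vec A c p i c = axis i 1"
  unfolding coord_vec_def by (simp only: assms if_True transition_derivative_self[OF assms])

text \<open>It is enough to compare the components in \<open>c\<close>, and there the coordinate vectors of \<open>c\<close> are the
  standard basis.\<close>

lemma tangent_vector_expansion:
  assumes v: "v \<in> tangent_space A p" and c: "c \<in> charts_at A p"
  shows "v = (\<Sum>i\<in>UNIV. (v c $ i) *\<^sub>R coord_vec A c p i)"
proof (rule tangent_vector_eqI[OF v _ c])
  have "(v c $ i) *\<^sub>R coord_vec A c p i \<in> tangent_space A p" for i
    by (rule subspace_scale[OF subspace_tangent_space coord_vec_in_tangent_space[OF c]])
  then show "(\<Sum>i\<in>UNIV. (v c $ i) *\<^sub>R coord_vec A c p i) \<in> tangent_space A p"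
    by (rule subspace_sum[OF subspace_tangent_space])
  have "(\<Sum>i\<in>UNIV. (v c $ i) *\<^sub>R coord_vec A c p i) c = (\<Sum>i\<in>UNIV. (v c $ i) *\<^sub>R axis i 1)"
    by (simp only: sum_fun_apply scaleR_fun_def coord_vec_apply_self[OF c])
  also have "\<dots> = v c"
    using basis_expansion[of "v c"] by (simp only: scalar_mult_eq_scaleR)
  finally show "v c = (\<Sum>i\<in>UNIV. (v c $ i) *\<^sub>R coord_vec A c p i) c"
    by (rule sym)
qed

lemma endo_apply_components:
  assumes h: "linear_field_on (tangent_space A p) (h p)"
    and v: "v \<in> tangent_space A p" and c: "c \<in> charts_at A p"
  shows "h p v c = endo_components A h c p *v v c"
proof -
  have "h p v = h p (\<Sum>j\<in>UNIV. (v c $ j) *\<^sub>R coord_vec A c p j)"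
    by (rule arg_cong[where f = "h p", OF tangent_vector_expansion[of v p c, OF v c]])
  also have "\<dots> = (\<Sum>j\<in>UNIV. (v c $ j) *\<^sub>R h p (coord_vec A c p j))"
  proof (rule linear_field_on_sum[OF h subspace_tangent_space])
    show "coord_vec A c p j \<in> tangent_space A p" for j
      using c by (rule coord_vec_in_tangent_space)
  qed
  finally have "h p v c = (\<Sum>j\<in>UNIV. (v c $ j) *\<^sub>R h p (coord_vec A c p j)) c"
    by (rule fun_cong)
  also have "\<dots> = (\<Sum>j\<in>UNIV. (v c $ j) *\<^sub>R h p (coord_vec A c p j) c)"
    by (simp only: sum_fun_apply scaleR_fun_def)
  also have "\<dots> = endo_components A h c p *v v c"
    by (simp add: vec_eq_iff matrix_vector_mult_def endo_components_def mult.commute)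
  finally show ?thesis .
qed

end

lemma circulant_cubed: "circulant *v (circulant *v (circulant *v x)) = x"
  by (simp add: circulant_def matrix_vector_mult_def vec_eq_iff forall_3 sum_3)

context circulant_manifold3
begin

text \<open>The circulant matrix permutes the three components cyclically.\<close>

lemma q_cubed:
  assumes p: "p \<in> topspace X" and v: "v \<in> tangent_space A p"
  shows "q p (q p (q p v)) = v"
proof -
  obtain c where c: "c \<in> charts_at A p"
    and circ: "\<forall>p'\<in>fst c. endo_components A q c p' = circulant"
    using q_circulant[OF p] by blast
  have "endo_components A q c p = circulant"
    using c circ by (simp add: charts_at_def)
  then have components: "q p u c = circulant *v u c" if "u \<in> tangent_space A p" for u
    using endo_apply_components[of p q, OF q_linear[OF p] that c] by (simp only:)
  note T = v q_tangent[OF p v] q_tangent[OF p q_tangent[OF p v]]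
  have "q p (q p (q p v)) c = v c"
    by (simp only: components[OF T(1)] components[OF T(2)] components[OF T(3)] circulant_cubed)
  then show ?thesis
    by (rule tangent_vector_eqI[OF q_tangent[OF p T(3)] v c])
qed

end

section \<open>Isometries of order three\<close>

text \<open>The laws are relative to a subspace \<open>T\<close>, because \<open>g\<close> and \<open>q\<close> are specified on tangent vectors
  only and not on the whole type they live in.\<close>

locale order_three_isometry =
  fixes T :: "'v::real_vector set" and h :: "'v \<Rightarrow> 'v \<Rightarrow> real" and Q :: "'v \<Rightarrow> 'v"
  assumes subspace: "subspace T"
    and add_right: "u \<in> T \<Longrightarrow> v \<in> T \<Longrightarrow> v' \<in> T \<Longrightarrow> h u (v + v') = h u v + h u v'"
    and scale_right: "u \<in> T \<Longrightarrow> v \<in> T \<Longrightarrow> h u (a *\<^sub>R v) = a * h u v"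
    and sym: "u \<in> T \<Longrightarrow> v \<in> T \<Longrightarrow> h u v = h v u"
    and nonneg: "u \<in> T \<Longrightarrow> h u u \<ge> 0"
    and Q_closed: "u \<in> T \<Longrightarrow> Q u \<in> T"
    and Q_add: "u \<in> T \<Longrightarrow> v \<in> T \<Longrightarrow> Q (u + v) = Q u + Q v"
    and Q_scale: "u \<in> T \<Longrightarrow> Q (a *\<^sub>R u) = a *\<^sub>R Q u"
    and Q_isometry: "u \<in> T \<Longrightarrow> v \<in> T \<Longrightarrow> h (Q u) (Q v) = h u v"
    and Q_cubed: "u \<in> T \<Longrightarrow> Q (Q (Q u)) = u"
begin

lemmas closed = subspace_add[OF subspace] subspace_scale[OF subspace] Q_closed

lemma add_left: "u \<in> T \<Longrightarrow> u' \<in> T \<Longrightarrow> v \<in> T \<Longrightarrow> h (u + u') v = h u v + h u' v"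
  using add_right sym closed by metis

lemma scale_left: "u \<in> T \<Longrightarrow> v \<in> T \<Longrightarrow> h (a *\<^sub>R u) v = a * h u v"
  using scale_right sym closed by metis

lemmas bilinear_expand = add_left add_right scale_left scale_right closed

text \<open>Applying the isometry to the pair \<open>(u, Q (Q u))\<close> gives \<open>(Q u, u)\<close>.\<close>

lemma orbit_inner:
  assumes "u \<in> T"
  shows "h u (Q (Q u)) = h u (Q u)"
  using Q_isometry[of u "Q (Q u)"] Q_cubed sym assms closed by metis

lemma quadratic_form_on_plane:
  assumes u: "u \<in> T" and unit: "h u u = 1"
  shows "h (a *\<^sub>R u + b *\<^sub>R Q u) (Q (a *\<^sub>R u + b *\<^sub>R Q u)) =
    h u (Q u) * (a\<^sup>2 + b\<^sup>2) + (1 + h u (Q u)) * a * b"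
proof -
  have "Q (a *\<^sub>R u + b *\<^sub>R Q u) = a *\<^sub>R Q u + b *\<^sub>R Q (Q u)"
    using u by (simp add: Q_add Q_scale closed)
  then show ?thesis
    using u unit orbit_inner[OF u]
    by (simp add: bilinear_expand Q_isometry algebra_simps power2_eq_square)
qed

text \<open>The Cauchy--Schwarz inequality for \<open>u\<close> and \<open>Q u\<close>, from \<open>h (u \<plusminus> Q u) (u \<plusminus> Q u) \<ge> 0\<close>; it
  guarantees that \<open>arccos\<close> in the definition of the angle is taken inside its proper domain.\<close>

lemma cos_angle:
  assumes u: "u \<in> T" and unit: "h u u = 1"
  shows "cos (angle h u (Q u)) = h u (Q u)"
proof -
  have Qu: "Q u \<in> T" "h (Q u) (Q u) = 1" "h (Q u) u = h u (Q u)"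
    using u unit by (simp_all add: closed Q_isometry sym)
  have "h (u + t *\<^sub>R Q u) (u + t *\<^sub>R Q u) = 1 + 2 * t * h u (Q u) + t\<^sup>2" for t
    using u Qu unit by (simp add: bilinear_expand power2_eq_square algebra_simps)
  then have "0 \<le> 1 + 2 * t * h u (Q u) + t\<^sup>2" for t
    using nonneg[of "u + t *\<^sub>R Q u"] u by (simp add: closed)
  from this[of 1] this[of "-1"] have "\<bar>h u (Q u)\<bar> \<le> 1"
    by simp
  then show ?thesis
    using Qu unit by (simp add: angle_def cos_arccos_abs)
qed

end

section \<open>Coordinates on the plane and the equation of the circle\<close>

text \<open>An orthonormal pair gives coordinates on its plane: inner products with the two vectors
  recover \<open>x\<close> and \<open>y\<close>.\<close>

lemma (in order_three_isometry) plane_coords_inj: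
  assumes "u \<in> T" "w \<in> T" "h u u = 1" "h w w = 1" "h u w = 0"
  shows "inj (plane_coords u w)"
proof (rule injI, clarify)
  fix x y x' y' assume eq: "plane_coords u w (x, y) = plane_coords u w (x', y')"
  have "h u (plane_coords u w (x, y)) = x \<and> h w (plane_coords u w (x, y)) = y" for x y
    using assms by (simp add: plane_coords_def bilinear_expand sym[of w u])
  with eq show "x = x' \<and> y = y'"
    by metis
qed

text \<open>Passing between the bases \<open>u, z\<close> and \<open>u, w\<close> is a triangular change with nonzero diagonal.\<close>

lemma range_plane_coords_gram_schmidt:
  fixes u z :: "'v::real_vector"
  assumes "s \<noteq> 0" and w: "w = (1 / s) *\<^sub>R (- c *\<^sub>R u + z)"
  shows "range (plane_coords u w) = span {u, z}"
proof
  show "range (plane_coords u w) \<subseteq> span {u, z}"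
  proof -
    have "u \<in> span {u, z}" "z \<in> span {u, z}"
      by (simp_all add: span_base)
    then have "x *\<^sub>R u + y *\<^sub>R w \<in> span {u, z}" for x y
      unfolding w by (intro span_add span_scale)
    then show ?thesis
      by (auto simp: plane_coords_def)
  qed
  show "span {u, z} \<subseteq> range (plane_coords u w)"
  proof
    fix v assume "v \<in> span {u, z}"
    then obtain a b where v: "v = a *\<^sub>R u + b *\<^sub>R z"
      by (auto simp: span_insert span_singleton algebra_simps)
    have "v = plane_coords u w (a + b * c, b * s)"
      using assms(1) by (simp add: v w plane_coords_def algebra_simps)
    then show "v \<in> range (plane_coords u w)"
      by blast
  qed
qed

text \<open>The quadratic form in the coefficients of \<open>u\<close> and \<open>q u\<close>, rewritten in \<open>x\<close> and \<open>y\<close>. The relation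
  \<open>s\<^sup>2 + c\<^sup>2 = 1\<close> cancels the factor \<open>1 - c\<close> from the coefficient of \<open>y\<^sup>2\<close>.\<close>

lemma circle_polynomial_identity:
  fixes c s x y :: real
  assumes s: "s \<noteq> 0" and pyth: "s\<^sup>2 = (1 - c) * (1 + c)"
  shows "c * ((x - y * c / s)\<^sup>2 + (y / s)\<^sup>2) + (1 + c) * (x - y * c / s) * (y / s) =
    c * x\<^sup>2 + (1 - c) * (1 + 2 * c) / s * x * y - c\<^sup>2 / (1 + c) * y\<^sup>2"
proof -
  have nz: "1 - c \<noteq> 0" "1 + c \<noteq> 0"
    using s pyth by auto
  have "c * ((x - y * c / s)\<^sup>2 + (y / s)\<^sup>2) + (1 + c) * (x - y * c / s) * (y / s) =
      c * x\<^sup>2 + (1 - c) * (1 + 2 * c) / s * x * y - c\<^sup>2 * (1 - c) / s\<^sup>2 * y\<^sup>2"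
    using s by (simp add: divide_simps power2_eq_square) algebra
  also have "c\<^sup>2 * (1 - c) / s\<^sup>2 = c\<^sup>2 / (1 + c)"
    using nz by (simp add: pyth)
  finally show ?thesis .
qed

theorem theorem5p1:
  fixes X :: "'a topology" and A :: "'a chart set"
    and g :: "'a \<Rightarrow> 'a tvec \<Rightarrow> 'a tvec \<Rightarrow> real" and q :: "'a \<Rightarrow> 'a tvec \<Rightarrow> 'a tvec"
    and p :: 'a and u w :: "'a tvec" and \<alpha> k :: "'a tvec set" and \<phi> r2 :: real
  assumes "circulant_manifold3 X A g q"
    and "p \<in> topspace X"
    and "u \<in> tangent_space A p" and "g p u u = 1" and "q p u \<noteq> u"
    and "\<alpha> = span {u, q p u}" and "dim \<alpha> = 2"
    and "\<phi> = angle (g p) u (q p u)" and "\<phi> \<in> {0<..2 * pi / 3}"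
    and "w = (1 / sin \<phi>) *\<^sub>R (- cos \<phi> *\<^sub>R u + q p u)"
    and "k = circle_in \<alpha> r2 (associated_metric g q p)"
  shows "bij_betw (plane_coords u w) UNIV \<alpha> \<and>
    (\<forall>x y. plane_coords u w (x, y) \<in> k \<longleftrightarrow>
       cos \<phi> * x\<^sup>2 + (1 - cos \<phi>) * (1 + 2 * cos \<phi>) / sin \<phi> * x * y
         - (cos \<phi>)\<^sup>2 / (1 + cos \<phi>) * y\<^sup>2 = r2 / 2)"
proof -
  interpret circulant_manifold3 X A g q by fact
  note p = \<open>p \<in> topspace X\<close> and u = \<open>u \<in> tangent_space A p\<close> and unit = \<open>g p u u = 1\<close>
  interpret order_three_isometry "tangent_space A p" "g p" "q p"
  proof
    show "0 \<le> g p v v" if v: "v \<in> tangent_space A p" for v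
    proof (cases "v = 0")
      case True
      \<comment> \<open>Positivity is assumed for nonzero vectors only; at zero, linearity gives the value.\<close>
      have "g p v (0 *\<^sub>R v) = 0 *\<^sub>R g p v v"
        using g_linear[OF p v] v unfolding linear_field_on_def by blast
      with True show ?thesis by simp
    qed (use g_pos[OF p v] in simp)
  qed (use p g_linear g_sym q_tangent q_linear q_isometry q_cubed subspace_tangent_space in
      \<open>auto simp: linear_field_on_def\<close>)
  define c where "c = cos \<phi>"
  define s where "s = sin \<phi>"
  have c: "g p u (q p u) = c"
    using cos_angle[OF u unit] \<open>\<phi> = angle (g p) u (q p u)\<close> by (simp add: c_def)
  have "0 < \<phi>" "\<phi> < pi"
    using \<open>\<phi> \<in> {0<..2 * pi / 3}\<close> pi_gt_zero by auto
  then have s: "s \<noteq> 0"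
    using sin_gt_zero[of \<phi>] by (simp add: s_def)
  have pyth: "s\<^sup>2 = (1 - c) * (1 + c)"
    by (simp add: c_def s_def sin_squared_eq algebra_simps power2_eq_square)
  have w: "w = (1 / s) *\<^sub>R (- c *\<^sub>R u + q p u)"
    using \<open>w = (1 / sin \<phi>) *\<^sub>R (- cos \<phi> *\<^sub>R u + q p u)\<close> by (simp add: c_def s_def)
  have w_comb: "w = (- c / s) *\<^sub>R u + (1 / s) *\<^sub>R q p u"
    by (simp add: w scaleR_right_diff_distrib)
  have Qu: "q p u \<in> tangent_space A p" "g p (q p u) (q p u) = 1" "g p (q p u) u = c"
    using u unit c by (simp_all add: closed Q_isometry sym)
  have wT: "w \<in> tangent_space A p"
    unfolding w_comb by (intro closed u)
  have inner_u: "g p u (a *\<^sub>R u + b *\<^sub>R q p u) = a + b * c" for a b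
    using u Qu unit c by (simp add: bilinear_expand)
  have norm_sq: "g p (a *\<^sub>R u + b *\<^sub>R q p u) (a *\<^sub>R u + b *\<^sub>R q p u) =
      a\<^sup>2 + b\<^sup>2 + 2 * a * b * c" for a b
    using u Qu unit c by (simp add: bilinear_expand power2_eq_square algebra_simps)
  have uw: "g p u w = 0"
    unfolding w_comb inner_u by simp
  have "g p w w = (1 - c\<^sup>2) / s\<^sup>2"
    unfolding w_comb norm_sq
    by (simp add: power_divide power2_eq_square flip: add_divide_distrib diff_divide_distrib)
  also have "1 - c\<^sup>2 = s\<^sup>2"
    unfolding pyth by (simp add: power2_eq_square algebra_simps)
  finally have ww: "g p w w = 1"
    using s by simp
  have "bij_betw (plane_coords u w) UNIV \<alpha>"
    using plane_coords_inj[OF u wT unit ww uw] range_plane_coords_gram_schmidt[OF s w]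
      \<open>\<alpha> = span {u, q p u}\<close> by (simp add: bij_betw_def)
  moreover have "plane_coords u w (x, y) \<in> k \<longleftrightarrow>
      c * x\<^sup>2 + (1 - c) * (1 + 2 * c) / s * x * y - c\<^sup>2 / (1 + c) * y\<^sup>2 = r2 / 2" for x y
  proof -
    let ?v = "plane_coords u w (x, y)"
    have v: "?v = (x - y * c / s) *\<^sub>R u + (y / s) *\<^sub>R q p u"
      by (simp add: plane_coords_def w_comb algebra_simps)
    then have "?v \<in> tangent_space A p"
      by (simp only: closed u)
    then have "associated_metric g q p ?v ?v = 2 * g p ?v (q p ?v)"
      using sym closed by (simp add: associated_metric_def)
    also have "g p ?v (q p ?v) =
        c * x\<^sup>2 + (1 - c) * (1 + 2 * c) / s * x * y - c\<^sup>2 / (1 + c) * y\<^sup>2"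
      unfolding v quadratic_form_on_plane[OF u unit] c
      by (rule circle_polynomial_identity[OF s pyth])
    finally have form: "associated_metric g q p ?v ?v =
        2 * (c * x\<^sup>2 + (1 - c) * (1 + 2 * c) / s * x * y - c\<^sup>2 / (1 + c) * y\<^sup>2)" .
    have "2 * z = r2 \<longleftrightarrow> z = r2 / 2" for z
      by auto
    then have "associated_metric g q p ?v ?v = r2 \<longleftrightarrow>
        c * x\<^sup>2 + (1 - c) * (1 + 2 * c) / s * x * y - c\<^sup>2 / (1 + c) * y\<^sup>2 = r2 / 2"
      unfolding form .
    moreover have "?v \<in> \<alpha>"
      using \<open>bij_betw (plane_coords u w) UNIV \<alpha>\<close> by (auto simp: bij_betw_def)
    ultimately show ?thesis
      using \<open>k = circle_in \<alpha> r2 (associated_metric g q p)\<close> by (simp add: circle_in_def)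
  qed
  ultimately show ?thesis
    by (simp add: c_def s_def)
qed

end
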